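(* Let $F$ be an n.b.d. space and let $\phi$ be a dimension function. For $\alpha\in(0,\infty)$ let $\phi_\alpha(R)=\phi(R)/\alpha$. Then $$\underline{\dim}_{\mathrm L}^{\phi}F=\inf_{0<\alpha<1}\dim_{\mathrm L}^{\phi_\alpha}F.$$
   Context: An n.b.d. space is a non-empty, bounded, doubling metric space $F$; doubling means that there is a constant $C>1$ such that for all $x\in F$ and $r>0$ the set $B(x,2r)\cap F$ can be covered by at most $C$ balls of radius $r$. $B(x,R)$ is the ball of centre $x$ and radius $R$, and $N_r(E)$ is the smallest number of balls of radius $r$ needed to cover $E$. A dimension function is a function $\phi:(0,1)\to(0,\infty)$ such that $\phi(R)$ decreases as $R\to0$, and $\phi(R)\log(1/R)$ increases to infinity as $R$ decreases to $0$ (monotonicity in the non-strict sense, so constant functions are allowed). The $\phi$-lower dimension of $F$ is $$\dim_{\mathrm L}^{\phi}F=\sup\Big\{s\ge0:\ \exists\,C>0 \text{ such that } \forall\, 0<R<1,\ \inf_{x\in F}N_{R^{1+\phi(R)}}(B(x,R)\cap F)\ge C\,R^{-\phi(R)s}\Big\}.$$ The quasi $\phi$-lower dimension of $F$ is $$\underline{\dim}_{\mathrm L}^{\phi}F=\sup\Big\{s\ge0:\ \exists\,C>0 \text{ such that } \forall\, 0<r\le R^{1+\phi(R)}<R<1,\ \inf_{x\in F}N_{r}(B(x,R)\cap F)\ge C\,(R/r)^{s}\Big\}.$$ *)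

theory Defs
  imports "HOL-Analysis.Analysis"
begin

text \<open>
  A metric space is modelled as a subset \<open>F\<close> of a type of class \<open>metric_space\<close>, with the induced
  metric. Balls are open. Everything is intrinsic to \<open>F\<close>: the balls used in a cover are centred at
  points of \<open>F\<close>.
\<close>

definition doubling :: "'a::metric_space set \<Rightarrow> bool" where
  "doubling F \<longleftrightarrow>
     (\<exists>C::real. C > 1 \<and>
        (\<forall>x\<in>F. \<forall>r>0. \<exists>A. A \<subseteq> F \<and> finite A \<and> real (card A) \<le> C \<and>
           ball x (2 * r) \<inter> F \<subseteq> (\<Union>a\<in>A. ball a r)))"

definition nbd_space :: "'a::metric_space set \<Rightarrow> bool" where
  "nbd_space F \<longleftrightarrow> F \<noteq> {} \<and> bounded F \<and> doubling F"

text \<open>The value is \<open>\<infinity>\<close> if there is no finite cover.\<close>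

definition covering_number :: "'a::metric_space set \<Rightarrow> real \<Rightarrow> 'a set \<Rightarrow> enat" where
  "covering_number F r E =
     (INF A \<in> {A. A \<subseteq> F \<and> finite A \<and> E \<subseteq> (\<Union>a\<in>A. ball a r)}. enat (card A))"

text \<open>Only the values of \<open>\<phi>\<close> on \<open>(0,1)\<close> are relevant.\<close>

definition dimension_function :: "(real \<Rightarrow> real) \<Rightarrow> bool" where
  "dimension_function \<phi> \<longleftrightarrow>
     (\<forall>R\<in>{0<..<1}. \<phi> R > 0) \<and>
     mono_on {0<..<1} \<phi> \<and>
     antimono_on {0<..<1} (\<lambda>R. \<phi> R * ln (1 / R)) \<and>
     filterlim (\<lambda>R. \<phi> R * ln (1 / R)) at_top (at_right 0)"

definition lower_dim :: "(real \<Rightarrow> real) \<Rightarrow> 'a::metric_space set \<Rightarrow> ereal" where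
  "lower_dim \<phi> F =
     Sup {ereal s | s. s \<ge> 0 \<and>
       (\<exists>C>0. \<forall>R. 0 < R \<and> R < 1 \<longrightarrow>
          ereal_of_enat (INF x\<in>F. covering_number F (R powr (1 + \<phi> R)) (ball x R \<inter> F))
            \<ge> ereal (C * R powr (- (\<phi> R * s))))}"

definition quasi_lower_dim :: "(real \<Rightarrow> real) \<Rightarrow> 'a::metric_space set \<Rightarrow> ereal" where
  "quasi_lower_dim \<phi> F =
     Sup {ereal s | s. s \<ge> 0 \<and>
       (\<exists>C>0. \<forall>r R. 0 < r \<and> r \<le> R powr (1 + \<phi> R) \<and> R powr (1 + \<phi> R) < R \<and> R < 1 \<longrightarrow>
          ereal_of_enat (INF x\<in>F. covering_number F r (ball x R \<inter> F))
            \<ge> ereal (C * (R / r) powr s))}"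

end

theory Submission imports Defs
begin

text \<open>
  Write \<open>N\<^sub>r(R)\<close> for the infimum over \<open>x \<in> F\<close> of the covering number of \<open>ball x R \<inter> F\<close> by
  balls of radius \<open>r\<close>. The quasi dimension never exceeds the dimension of \<open>\<phi> / \<alpha>\<close>, because
  the radius \<open>r = R powr (1 + \<phi> R / \<alpha>)\<close> is one of the radii that the former tests.

  For the converse take \<open>t < s\<close> with \<open>s\<close> below the dimension of \<open>\<phi> / \<alpha>\<close> for every
  \<open>\<alpha> \<in> (0,1)\<close>. Then \<open>N\<^sub>r(R) \<ge> c (R / r)\<^sup>s\<close> whenever
  \<open>r = R powr (1 + \<phi> R / \<alpha>)\<close>, but the constant \<open>c\<close> depends on \<open>\<alpha>\<close> and may vanish as
  \<open>\<alpha>\<close> tends to \<open>0\<close> or \<open>1\<close>. On a logarithmic scale, with \<open>g R = \<phi> R * ln (1 / R)\<close>, such an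
  \<open>r\<close> satisfies \<open>ln (R / r) = g R / \<alpha>\<close>, and the required range is \<open>ln (R / r) \<ge> g R\<close>.
  Three ideas restore uniformity.

  (1) In a doubling space, enlarging the covering radius by a factor \<open>k\<close> divides the covering
  number by at most \<open>C k\<^sup>d\<close> with \<open>d = log 2 C\<close> (\<open>cover_lb_coarsen\<close>). Hence for \<open>ln (R / r)\<close> between \<open>g R\<close> and
  \<open>M * g R\<close>, with \<open>M\<close> fixed, finitely many \<open>\<alpha>\<close>, whose inverses form a geometric progression
  with ratio close to \<open>1\<close>, suffice: the next smaller grid radius differs from \<open>r\<close> by a small
  power of \<open>R / r\<close>, at the price of a slightly smaller exponent
  (\<open>cover_lb_intermediate_scales\<close>).

  (2) Covering numbers are supermultiplicative up to constants (\<open>cover_lb_mult\<close>): in a ball of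
  radius \<open>2 * R\<close> one finds many disjoint balls of an intermediate radius, and no small ball meets
  two of them. So a very small \<open>r\<close> is reached by passing repeatedly from \<open>R\<close> to
  \<open>(R / 2) powr (1 + \<phi> (R / 2))\<close>. The monotonicity of \<open>\<phi>\<close> makes \<open>g\<close> at this new radius at
  most a constant times \<open>g R\<close> (\<open>log_gap_next_scale\<close>), so for \<open>M\<close> large the iteration stays in
  the admissible range until (1) applies.

  (3) Each step loses a constant factor, which unchecked would accumulate. Since \<open>g R\<close> tends to
  infinity, \<open>(R / r)\<close> raised to the spare exponent \<open>s - t\<close> outweighs any constant once \<open>R\<close> is
  small; each step then yields \<open>(R / r)\<^sup>t\<close> without loss (\<open>cover_lb_small_scales\<close>). Radii
  \<open>R\<close> bounded away from \<open>0\<close> are compared with one fixed small radius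
  (\<open>cover_lb_all_scales\<close>).
\<close>

section \<open>Uniform lower bounds for covering numbers\<close>

definition is_cover :: "'a::metric_space set \<Rightarrow> real \<Rightarrow> 'a set \<Rightarrow> 'a set \<Rightarrow> bool" where
  "is_cover F r E A \<longleftrightarrow> A \<subseteq> F \<and> finite A \<and> E \<subseteq> (\<Union>a\<in>A. ball a r)"

text \<open>
  The bound \<open>v \<le> N\<^sub>r(R)\<close> is expressed by quantifying over covers, so that no extended number
  and no question of finiteness enters the geometric arguments.
\<close>

definition cover_lb :: "'a::metric_space set \<Rightarrow> real \<Rightarrow> real \<Rightarrow> real \<Rightarrow> bool" where
  "cover_lb F R r v \<longleftrightarrow> (\<forall>x\<in>F. \<forall>A. is_cover F r (ball x R \<inter> F) A \<longrightarrow> v \<le> real (card A))"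

lemma ereal_le_of_enat_Inf_iff:
  "ereal v \<le> ereal_of_enat (Inf S) \<longleftrightarrow> (\<forall>n\<in>S. ereal v \<le> ereal_of_enat n)"
proof (cases "S = {}")
  case True
  then show ?thesis by (simp add: Inf_enat_def)
next
  case False
  then have mem: "Inf S \<in> S"
    by (auto simp: Inf_enat_def intro: LeastI)
  show ?thesis
  proof
    assume a: "ereal v \<le> ereal_of_enat (Inf S)"
    show "\<forall>n\<in>S. ereal v \<le> ereal_of_enat n"
    proof
      fix n assume "n \<in> S"
      then have "ereal_of_enat (Inf S) \<le> ereal_of_enat n"
        by (simp add: Inf_lower)
      with a show "ereal v \<le> ereal_of_enat n" by (rule order_trans)
    qed
  qed (use mem in blast)
qed

lemma cover_lb_iff:
  "ereal v \<le> ereal_of_enat (INF x\<in>F. covering_number F r (ball x R \<inter> F)) \<longleftrightarrow> cover_lb F R r v"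
proof -
  have "ereal v \<le> ereal_of_enat (covering_number F r E) \<longleftrightarrow>
      (\<forall>A. is_cover F r E A \<longrightarrow> v \<le> real (card A))" for E
    unfolding covering_number_def ereal_le_of_enat_Inf_iff is_cover_def by simp
  then show ?thesis unfolding ereal_le_of_enat_Inf_iff cover_lb_def by simp
qed

lemma cover_lb_weaken:
  assumes "cover_lb F R r v" "R \<le> R'" "w \<le> v"
  shows "cover_lb F R' r w"
  unfolding cover_lb_def
proof (intro ballI allI impI)
  fix x A assume x: "x \<in> F" and A: "is_cover F r (ball x R' \<inter> F) A"
  have "ball x R \<subseteq> ball x R'" using assms(2) by (rule subset_ball)
  then have "is_cover F r (ball x R \<inter> F) A"
    using A unfolding is_cover_def by blast
  then show "w \<le> real (card A)"
    using assms(1,3) x unfolding cover_lb_def by force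
qed

lemma cover_lb_one:
  assumes "R > 0"
  shows "cover_lb F R r 1"
  unfolding cover_lb_def
proof (intro ballI allI impI)
  fix x A assume "x \<in> F" "is_cover F r (ball x R \<inter> F) A"
  moreover from this have "x \<in> ball x R \<inter> F" using assms by simp
  ultimately have "A \<noteq> {}" "finite A" unfolding is_cover_def by blast+
  then have "card A \<noteq> 0" by simp
  then show "1 \<le> real (card A)" by linarith
qed

section \<open>Change of the covering radius\<close>

definition doubling_const :: "'a::metric_space set \<Rightarrow> real \<Rightarrow> bool" where
  "doubling_const F C \<longleftrightarrow> C > 1 \<and>
     (\<forall>x\<in>F. \<forall>r>0. \<exists>A. is_cover F r (ball x (2 * r) \<inter> F) A \<and> real (card A) \<le> C)"

lemma doubling_constE:
  assumes "doubling F"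
  obtains C where "doubling_const F C"
proof -
  obtain C where "C > 1" and C: "\<And>x r. x \<in> F \<Longrightarrow> r > 0 \<Longrightarrow>
      \<exists>A\<subseteq>F. finite A \<and> real (card A) \<le> C \<and> ball x (2 * r) \<inter> F \<subseteq> (\<Union>a\<in>A. ball a r)"
    using assms unfolding doubling_def by auto
  have "\<exists>A. is_cover F r (ball x (2 * r) \<inter> F) A \<and> real (card A) \<le> C" if "x \<in> F" "r > 0" for x r
    using C[OF that] unfolding is_cover_def by blast
  with \<open>C > 1\<close> have "doubling_const F C" unfolding doubling_const_def by blast
  then show ?thesis by (rule that)
qed

text \<open>Each ball of the given cover is replaced by the cover that doubling supplies for it.\<close>

lemma is_cover_halve:
  assumes D: "doubling_const F C" and A: "is_cover F r E A" and "E \<subseteq> F" "r > 0"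
  shows "\<exists>B. is_cover F (r / 2) E B \<and> real (card B) \<le> C * real (card A)"
proof -
  have "\<forall>a\<in>A. \<exists>B. is_cover F (r/2) (ball a r \<inter> F) B \<and> real (card B) \<le> C"
  proof
    fix a assume "a \<in> A"
    then have "a \<in> F" using A unfolding is_cover_def by auto
    then show "\<exists>B. is_cover F (r/2) (ball a r \<inter> F) B \<and> real (card B) \<le> C"
      using D \<open>r > 0\<close> unfolding doubling_const_def
      by (elim conjE ballE[of _ _ a] allE[of _ "r/2"]) auto
  qed
  then obtain B where B: "\<And>a. a \<in> A \<Longrightarrow> is_cover F (r/2) (ball a r \<inter> F) (B a)"
      and cB: "\<And>a. a \<in> A \<Longrightarrow> real (card (B a)) \<le> C" by metis
  have finA: "finite A" using A unfolding is_cover_def by auto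
  have "is_cover F (r/2) E (\<Union>a\<in>A. B a)"
    unfolding is_cover_def
  proof (intro conjI)
    show "(\<Union>a\<in>A. B a) \<subseteq> F" "finite (\<Union>a\<in>A. B a)"
      using B finA unfolding is_cover_def by auto
    show "E \<subseteq> (\<Union>b\<in>\<Union>a\<in>A. B a. ball b (r/2))"
    proof
      fix z assume z: "z \<in> E"
      then obtain a where a: "a \<in> A" "z \<in> ball a r" using A unfolding is_cover_def by blast
      then have "z \<in> (\<Union>b\<in>B a. ball b (r/2))"
        using B[OF a(1)] z \<open>E \<subseteq> F\<close> unfolding is_cover_def by blast
      then show "z \<in> (\<Union>b\<in>\<Union>a\<in>A. B a. ball b (r/2))" using a by blast
    qed
  qed
  moreover have "real (card (\<Union>a\<in>A. B a)) \<le> C * real (card A)"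
  proof -
    have "real (card (\<Union>a\<in>A. B a)) \<le> real (\<Sum>a\<in>A. card (B a))"
      using card_UN_le[OF finA, of B] by linarith
    also have "\<dots> \<le> (\<Sum>a\<in>A. C)" unfolding of_nat_sum by (rule sum_mono) (rule cB)
    finally show ?thesis by (simp add: mult.commute)
  qed
  ultimately show ?thesis by blast
qed

lemma is_cover_halve_iterate:
  assumes D: "doubling_const F C" and A: "is_cover F r E A" and "E \<subseteq> F" "r > 0"
  shows "\<exists>B. is_cover F (r / 2 ^ n) E B \<and> real (card B) \<le> C ^ n * real (card A)"
proof (induction n)
  case 0
  then show ?case using A by auto
next
  case (Suc n)
  then obtain B where B: "is_cover F (r / 2 ^ n) E B" "real (card B) \<le> C ^ n * real (card A)"
    by blast
  from is_cover_halve[OF D B(1) \<open>E \<subseteq> F\<close>] \<open>r > 0\<close> obtain B' where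
    B': "is_cover F (r / 2 ^ n / 2) E B'" "real (card B') \<le> C * real (card B)" by auto
  have "C * real (card B) \<le> C * (C ^ n * real (card A))"
    using B(2) D unfolding doubling_const_def by (intro mult_left_mono) auto
  with B' show ?case by (intro exI[of _ B']) (auto simp: mult_ac)
qed

lemma is_cover_mono_radius:
  assumes "is_cover F r E A" "r \<le> r'"
  shows "is_cover F r' E A"
proof -
  have "ball a r \<subseteq> ball a r'" for a using assms(2) by (rule subset_ball)
  then show ?thesis using assms(1) unfolding is_cover_def by blast
qed

text \<open>
  A cover of radius \<open>r'\<close> is refined to radius at most \<open>r\<close> by about \<open>log 2 (r' / r)\<close> halvings,
  each multiplying the cardinality by at most \<open>C\<close>, and
  \<open>C powr log 2 (r' / r) = (r' / r) powr log 2 C\<close>.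
\<close>

lemma cover_lb_coarsen:
  assumes D: "doubling_const F C" and lb: "cover_lb F R r v" and r: "0 < r" "r \<le> r'"
  shows "cover_lb F R r' (v / (C * (r' / r) powr log 2 C))"
  unfolding cover_lb_def
proof (intro ballI allI impI)
  fix x A assume x: "x \<in> F" and A: "is_cover F r' (ball x R \<inter> F) A"
  have C: "C > 1" using D unfolding doubling_const_def by auto
  define n where "n = nat \<lceil>log 2 (r' / r)\<rceil>"
  have l0: "log 2 (r' / r) \<ge> 0" using r by simp
  have n1: "log 2 (r' / r) \<le> real n" and n2: "real n \<le> log 2 (r' / r) + 1"
    unfolding n_def using l0 by linarith+
  have "r' / r = 2 powr log 2 (r' / r)" using r by simp
  also have "\<dots> \<le> 2 powr real n" using n1 by simp
  also have "\<dots> = 2 ^ n" by (simp add: powr_realpow)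
  finally have le: "r' / 2 ^ n \<le> r" using r by (simp add: field_simps)
  obtain B where B: "is_cover F (r' / 2 ^ n) (ball x R \<inter> F) B"
      "real (card B) \<le> C ^ n * real (card A)"
    using is_cover_halve_iterate[OF D A, of n] r by auto
  have "v \<le> real (card B)"
    using lb x is_cover_mono_radius[OF B(1) le] unfolding cover_lb_def by blast
  also note B(2)
  also have "C ^ n * real (card A) \<le> (C * (r' / r) powr log 2 C) * real (card A)"
  proof (rule mult_right_mono)
    have "C ^ n = C powr real n" using C by (simp add: powr_realpow)
    also have "\<dots> \<le> C powr (log 2 (r' / r) + 1)" using n2 C by simp
    also have "\<dots> = C * C powr (log 2 (r' / r))" using C by (simp add: powr_add)
    also have "C powr (log 2 (r' / r)) = (r' / r) powr log 2 C"
      using C r by (simp add: powr_def log_def mult.commute)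
    finally show "C ^ n \<le> C * (r' / r) powr log 2 C" .
  qed simp
  finally have "v \<le> (C * (r' / r) powr log 2 C) * real (card A)" .
  moreover have "C * (r' / r) powr log 2 C > 0" using C r by simp
  ultimately show "v / (C * (r' / r) powr log 2 C) \<le> real (card A)"
    by (simp add: divide_le_eq mult.commute)
qed

section \<open>Supermultiplicativity\<close>

text \<open>
  Take a largest \<open>4 * \<rho>\<close>-separated subset \<open>Y\<close> of \<open>ball x R \<inter> F\<close>. Being maximal, it provides
  a cover of radius \<open>4 * \<rho>\<close>, so it has at least \<open>v\<close> points. The balls of radius \<open>\<rho>\<close>
  around these points lie in \<open>ball x (2 * R)\<close>, each needs at least \<open>w\<close> balls of radius \<open>r\<close>, and
  these sets of small balls are disjoint since \<open>r \<le> \<rho>\<close>.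
\<close>

lemma cover_lb_mult:
  assumes lb1: "cover_lb F R (4 * \<rho>) v" and lb2: "cover_lb F \<rho> r w"
    and r: "0 < r" "r \<le> \<rho>" "\<rho> \<le> R" and w: "w \<ge> 0"
  shows "cover_lb F (2 * R) r (v * w)"
  unfolding cover_lb_def
proof (intro ballI allI impI)
  fix x A assume x: "x \<in> F" and A: "is_cover F r (ball x (2 * R) \<inter> F) A"
  have finA: "finite A" and AF: "A \<subseteq> F" using A unfolding is_cover_def by auto
  define near where "near y = {a \<in> A. ball a r \<inter> ball y \<rho> \<noteq> {}}" for y
  define sep where "sep Y \<longleftrightarrow> finite Y \<and> Y \<subseteq> ball x R \<inter> F \<and>
      (\<forall>y\<in>Y. \<forall>y'\<in>Y. y \<noteq> y' \<longrightarrow> dist y y' \<ge> 4 * \<rho>)" for Y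
  have cov: "is_cover F r (ball y \<rho> \<inter> F) (near y)" if y: "y \<in> ball x R" for y
    unfolding is_cover_def
  proof (intro conjI)
    show "near y \<subseteq> F" "finite (near y)" using finA AF unfolding near_def by auto
    show "ball y \<rho> \<inter> F \<subseteq> (\<Union>a\<in>near y. ball a r)"
    proof
      fix z assume z: "z \<in> ball y \<rho> \<inter> F"
      have "dist x z \<le> dist x y + dist y z" by (rule dist_triangle)
      also have "\<dots> < 2 * R" using z y r by auto
      finally obtain a where "a \<in> A" "z \<in> ball a r"
        using A z unfolding is_cover_def by fastforce
      then show "z \<in> (\<Union>a\<in>near y. ball a r)" using z unfolding near_def by blast
    qed
  qed
  have disj: "near y \<inter> near y' = {}" if "dist y y' \<ge> 4 * \<rho>" for y y'
  proof (rule ccontr)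
    assume "near y \<inter> near y' \<noteq> {}"
    then obtain a p p' where p: "dist a p < r" "dist y p < \<rho>" "dist a p' < r" "dist y' p' < \<rho>"
      unfolding near_def by auto
    have "dist y y' \<le> dist y p + dist p a + dist a p' + dist p' y'"
      using dist_triangle[of y y' p] dist_triangle[of p y' a] dist_triangle[of a y' p'] by linarith
    then show False using p that r by (auto simp: dist_commute)
  qed
  have card_sum: "(\<Sum>y\<in>Y. card (near y)) \<le> card A" if "sep Y" for Y
  proof -
    have "(\<Sum>y\<in>Y. card (near y)) = card (\<Union>y\<in>Y. near y)"
      using that finA disj unfolding sep_def
      by (intro card_UN_disjoint[symmetric]) (auto simp: near_def)
    also have "\<dots> \<le> card A" using finA by (intro card_mono) (auto simp: near_def)
    finally show ?thesis .
  qed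
  \<comment> \<open>a bound on the size of separated sets, which makes a largest one exist\<close>
  have bound: "card Y \<le> card A" if "sep Y" for Y
  proof -
    have "card Y = (\<Sum>y\<in>Y. 1)" by simp
    also have "\<dots> \<le> (\<Sum>y\<in>Y. card (near y))"
    proof (rule sum_mono)
      fix y assume "y \<in> Y"
      then have "y \<in> ball x R" "y \<in> F" using that unfolding sep_def by auto
      then have "1 \<le> real (card (near y))"
        using cover_lb_one[of \<rho> F r] cov r unfolding cover_lb_def by fastforce
      then show "1 \<le> card (near y)" by linarith
    qed
    finally show ?thesis using card_sum[OF that] by linarith
  qed
  have "sep {}" unfolding sep_def by auto
  then obtain Y where Y: "sep Y" and max: "\<And>Z. sep Z \<Longrightarrow> card Z \<le> card Y"
    using ex_has_greatest_nat[of sep "{}" card "Suc (card A)"] bound by (auto simp: less_Suc_eq_le)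
  have "is_cover F (4 * \<rho>) (ball x R \<inter> F) Y"
    unfolding is_cover_def
  proof (intro conjI)
    show "Y \<subseteq> F" "finite Y" using Y unfolding sep_def by auto
    show "ball x R \<inter> F \<subseteq> (\<Union>a\<in>Y. ball a (4 * \<rho>))"
    proof
      fix z assume z: "z \<in> ball x R \<inter> F"
      show "z \<in> (\<Union>a\<in>Y. ball a (4 * \<rho>))"
      proof (rule ccontr)
        assume n: "z \<notin> (\<Union>a\<in>Y. ball a (4 * \<rho>))"
        then have far: "\<And>y. y \<in> Y \<Longrightarrow> dist y z \<ge> 4 * \<rho>" by force
        then have "z \<notin> Y" using r by force
        moreover have "sep (insert z Y)"
          using Y z far unfolding sep_def by (auto simp: dist_commute)
        ultimately show False using max[of "insert z Y"] Y unfolding sep_def by auto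
      qed
    qed
  qed
  then have "v \<le> real (card Y)" using lb1 x unfolding cover_lb_def by blast
  then have "v * w \<le> (\<Sum>y\<in>Y. w)" using w by (simp add: mult_right_mono)
  also have "\<dots> \<le> (\<Sum>y\<in>Y. real (card (near y)))"
  proof (rule sum_mono)
    fix y assume "y \<in> Y"
    then have "y \<in> ball x R" "y \<in> F" using Y unfolding sep_def by auto
    then show "w \<le> real (card (near y))" using lb2 cov unfolding cover_lb_def by blast
  qed
  also have "\<dots> \<le> real (card A)" using card_sum[OF Y] by (metis of_nat_le_iff of_nat_sum)
  finally show "v * w \<le> real (card A)" .
qed

section \<open>Dimension functions on the logarithmic scale\<close>

text \<open>
  With \<open>R = exp (- L)\<close>, the radius \<open>R powr (1 + \<phi> R)\<close> is \<open>exp (- (L + log_gap \<phi> R))\<close>.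
  The covering radii \<open>r\<close> that the quasi dimension tests at \<open>R\<close> are those with
  \<open>ln (R / r) \<ge> log_gap \<phi> R\<close>.
\<close>

definition log_gap :: "(real \<Rightarrow> real) \<Rightarrow> real \<Rightarrow> real" where
  "log_gap \<phi> R = \<phi> R * ln (1 / R)"

lemma log_gap_pos:
  assumes "dimension_function \<phi>" "0 < R" "R < 1"
  shows "log_gap \<phi> R > 0"
  using assms unfolding dimension_function_def log_gap_def by (auto intro!: mult_pos_pos)

text \<open>
  As a function of \<open>L = ln (1 / R)\<close>, the quotient of the gap by \<open>L\<close> is \<open>\<phi> R\<close>, which decreases as
  \<open>L\<close> grows. The inequality is cross-multiplied to avoid division.
\<close>

lemma log_gap_sublinear:
  assumes "dimension_function \<phi>" "0 < R'" "R' \<le> R" "R < 1"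
  shows "log_gap \<phi> R' * ln (1 / R) \<le> log_gap \<phi> R * ln (1 / R')"
proof -
  have "\<phi> R' \<le> \<phi> R"
    using assms unfolding dimension_function_def by (auto dest!: mono_onD[where r = R' and s = R])
  moreover have "0 \<le> ln (1 / R') * ln (1 / R)" using assms by (intro mult_nonneg_nonneg) auto
  ultimately have "\<phi> R' * (ln (1 / R') * ln (1 / R)) \<le> \<phi> R * (ln (1 / R') * ln (1 / R))"
    by (rule mult_right_mono)
  then show ?thesis unfolding log_gap_def by (simp add: mult_ac)
qed

lemma log_gap_large:
  assumes "dimension_function \<phi>"
  obtains b where "0 < b" "\<And>R. 0 < R \<Longrightarrow> R < b \<Longrightarrow> Z \<le> log_gap \<phi> R"
proof -
  have "eventually (\<lambda>R. Z \<le> log_gap \<phi> R) (at_right 0)"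
    using assms unfolding dimension_function_def log_gap_def filterlim_at_top by auto
  then show ?thesis using that unfolding eventually_at_right_field by auto
qed

lemma powr_log_gap:
  assumes "0 < R"
  shows "R powr (1 + \<phi> R * k) = R * exp (- (k * log_gap \<phi> R))"
    and "R powr (- (\<phi> R * k)) = exp (k * log_gap \<phi> R)"
  using assms by (simp_all add: powr_def log_gap_def ln_div exp_add algebra_simps)

lemma le_powr_iff_log_gap:
  assumes "0 < R" "0 < r"
  shows "r \<le> R powr (1 + \<phi> R) \<longleftrightarrow> log_gap \<phi> R \<le> ln (R / r)"
proof -
  have "r \<le> R powr (1 + \<phi> R) \<longleftrightarrow> ln r \<le> ln (R powr (1 + \<phi> R))"
    using assms by (intro ln_le_cancel_iff[symmetric]) auto
  also have "\<dots> \<longleftrightarrow> log_gap \<phi> R \<le> ln (R / r)"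
    using assms by (simp add: ln_powr ln_div log_gap_def algebra_simps)
  finally show ?thesis .
qed

section \<open>Interpolation and iteration of scales\<close>

text \<open>
  The inverses of the chosen \<open>\<alpha>\<close> are the powers \<open>q ^ n\<close> of a number \<open>q > 1\<close>. If \<open>r'\<close> is the grid
  radius just below \<open>r\<close>, then \<open>r / r' \<le> (R / r) powr (q - 1)\<close>, so passing from \<open>r'\<close> to \<open>r\<close>
  lowers the exponent \<open>s\<close> by at most \<open>(q - 1) * d\<close>. Choosing \<open>q\<close> such that this is half of
  \<open>s - t\<close> leaves the other half \<open>\<eta>\<close> to absorb all constants, including the arbitrary \<open>K\<close>
  that the iteration will consume.
\<close>

lemma cover_lb_intermediate_scales:
  assumes D: "doubling_const F C" and \<phi>: "dimension_function \<phi>"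
    and lower: "\<And>\<alpha>. 0 < \<alpha> \<Longrightarrow> \<alpha> < 1 \<Longrightarrow>
      \<exists>c>0. \<forall>R. 0 < R \<and> R < 1 \<longrightarrow>
        cover_lb F R (R powr (1 + \<phi> R / \<alpha>)) (c * R powr (- (\<phi> R / \<alpha> * s)))"
    and t: "0 \<le> t" "t < s" and K: "K > 0"
  shows "\<exists>b>0. \<forall>R r. 0 < R \<and> R < b \<and> R < 1 \<and> 0 < r \<and> log_gap \<phi> R \<le> ln (R / r)
      \<and> ln (R / r) \<le> M * log_gap \<phi> R \<longrightarrow> cover_lb F R r (K * (R / r) powr t)"
proof -
  have C: "C > 1" using D unfolding doubling_const_def by auto
  define d where "d = log 2 C"
  have d: "d > 0" unfolding d_def using C by simp
  define \<eta> where "\<eta> = (s - t) / 2"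
  define \<epsilon> where "\<epsilon> = \<eta> / d"
  define q where "q = 1 + \<epsilon>"
  have \<eta>: "\<eta> > 0" unfolding \<eta>_def using t by simp
  have \<epsilon>: "\<epsilon> > 0" unfolding \<epsilon>_def using d \<eta> by simp
  have q: "q > 1" unfolding q_def using \<epsilon> by simp
  have \<epsilon>d: "s - \<epsilon> * d = t + \<eta>" unfolding \<epsilon>_def \<eta>_def using d by (simp add: field_simps)
  obtain J where J: "M < q ^ J" using real_arch_pow[OF q] by blast
  have "\<exists>c>0. \<forall>R. 0 < R \<and> R < 1 \<longrightarrow>
        cover_lb F R (R * exp (- (q ^ n * log_gap \<phi> R))) (c * exp (q ^ n * s * log_gap \<phi> R))"
    if "n \<ge> 1" for n
  proof -
    have "q ^ n > 1" using q that by simp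
    then have "0 < 1 / q ^ n" "1 / q ^ n < 1" by (auto simp: field_simps)
    from lower[OF this] show ?thesis
      by (simp add: powr_log_gap mult.assoc)
  qed
  then obtain c where c: "\<And>n. n \<ge> 1 \<Longrightarrow> c n > 0" and
    lb: "\<And>n R. n \<ge> 1 \<Longrightarrow> 0 < R \<Longrightarrow> R < 1 \<Longrightarrow>
        cover_lb F R (R * exp (- (q ^ n * log_gap \<phi> R))) (c n * exp (q ^ n * s * log_gap \<phi> R))"
    by metis
  \<comment> \<open>\<open>Suc J\<close> instead of \<open>J\<close> keeps the index set nonempty\<close>
  define c0 where "c0 = Min (c ` {1..Suc J})"
  have c0: "c0 > 0" unfolding c0_def using c by (subst Min_gr_iff) auto
  have c0_le: "c0 \<le> c n" if "1 \<le> n" "n \<le> J" for n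
    unfolding c0_def using that by (intro Min_le) auto
  obtain b where b: "0 < b" "\<And>R. 0 < R \<Longrightarrow> R < b \<Longrightarrow> ln (K * C / c0) / \<eta> \<le> log_gap \<phi> R"
    using log_gap_large[OF \<phi>] by blast
  have "cover_lb F R r (K * (R / r) powr t)"
    if R: "0 < R" "R < b" "R < 1" and r: "0 < r" and l1: "log_gap \<phi> R \<le> ln (R / r)"
      and l2: "ln (R / r) \<le> M * log_gap \<phi> R" for R r
  proof -
    define g where "g = log_gap \<phi> R"
    define l where "l = ln (R / r)"
    have g: "g > 0" unfolding g_def using log_gap_pos[OF \<phi>] R by blast
    have gl: "g \<le> l" "l \<le> M * g" using l1 l2 unfolding g_def l_def by auto
    have Rr: "R = r * exp l" unfolding l_def using R r by (simp add: exp_ln)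
    \<comment> \<open>the first grid radius strictly below \<open>r\<close>; \<open>n \<noteq> 0\<close> since \<open>l \<ge> g\<close>, so \<open>1 / q ^ n < 1\<close>\<close>
    define n where "n = (LEAST n. l < q ^ n * g)"
    have "l < q ^ J * g" using gl J g by (meson le_less_trans mult_strict_right_mono)
    then have n1: "l < q ^ n * g" and nJ: "n \<le> J"
      unfolding n_def by (auto intro: LeastI Least_le)
    have n0: "n \<noteq> 0"
    proof
      assume "n = 0"
      then show False using n1 gl by simp
    qed
    then obtain m where m: "n = Suc m" by (cases n) auto
    have "\<not> l < q ^ m * g" using not_less_Least[of m "\<lambda>n. l < q ^ n * g"] m n_def by auto
    then have n2: "q ^ n * g \<le> q * l" using m q by (simp add: mult.assoc)
    define r' where "r' = R * exp (- (q ^ n * g))"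
    have r': "r' > 0" "r / r' = exp (q ^ n * g - l)"
      unfolding r'_def using R r by (simp_all add: Rr exp_diff exp_minus field_simps)
    have "r' = r / exp (q ^ n * g - l)" using r' r by (simp add: field_simps)
    also have "\<dots> \<le> r / 1" using n1 r by (intro divide_left_mono) auto
    finally have r'r: "r' \<le> r" by simp
    have "cover_lb F R r' (c n * exp (q ^ n * s * g))"
      unfolding r'_def g_def using lb[of n R] n0 R by auto
    from cover_lb_coarsen[OF D this r'(1) r'r]
    have "cover_lb F R r (c n * exp (q ^ n * s * g) / (C * exp (q ^ n * g - l) powr d))"
      unfolding r'(2) d_def .
    moreover have "K * (R / r) powr t \<le> c n * exp (q ^ n * s * g) / (C * exp (q ^ n * g - l) powr d)"
    proof -
      have "ln (K * C / c0) \<le> \<eta> * g" using b(2)[of R] R \<eta> unfolding g_def by (simp add: field_simps)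
      also have "\<dots> \<le> \<eta> * l" using gl \<eta> by simp
      finally have "K * C / c0 \<le> exp (\<eta> * l)"
        using K C c0 ln_ge_iff[of "K * C / c0" "\<eta> * l"] exp_le_cancel_iff[of "ln (K * C / c0)" "\<eta> * l"]
        by simp
      then have 1: "K * C \<le> c0 * exp (\<eta> * l)" using c0 by (simp add: field_simps)
      have 2: "t * l + (q ^ n * g - l) * d + \<eta> * l \<le> q ^ n * s * g"
      proof -
        have "(q ^ n * g - l) * d \<le> (\<epsilon> * l) * d"
          using n2 d unfolding q_def by (intro mult_right_mono) (auto simp: algebra_simps)
        moreover have "l * s \<le> q ^ n * g * s" using n1 t by (intro mult_right_mono) auto
        moreover have "l * s = \<epsilon> * l * d + t * l + \<eta> * l"
        proof -
          have "s = \<epsilon> * d + t + \<eta>" using \<epsilon>d by linarith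
          then show ?thesis by (simp add: algebra_simps)
        qed
        ultimately show ?thesis by (simp add: algebra_simps)
      qed
      have "K * (R / r) powr t * (C * exp (q ^ n * g - l) powr d)
          = (K * C) * exp (t * l + (q ^ n * g - l) * d)"
        using r by (simp add: Rr powr_def exp_add mult_ac)
      also have "\<dots> \<le> (c0 * exp (\<eta> * l)) * exp (t * l + (q ^ n * g - l) * d)"
        using 1 by (intro mult_right_mono) auto
      also have "\<dots> = c0 * exp (t * l + (q ^ n * g - l) * d + \<eta> * l)"
        by (simp add: exp_add mult_ac)
      also have "\<dots> \<le> c n * exp (q ^ n * s * g)"
        using 2 c0_le[of n] c0 n0 nJ by (intro mult_mono) auto
      finally show ?thesis using C by (subst le_divide_eq) auto
    qed
    ultimately show ?thesis by (rule cover_lb_weaken[OF _ order_refl])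
  qed
  with b(1) show ?thesis by blast
qed

text \<open>
  Halving \<open>R\<close> at most doubles \<open>L = ln (1 / R)\<close>, and one further step adds at most \<open>2 * \<phi> R * L\<close>;
  by sublinearity the gap grows by no larger a factor than \<open>L\<close>. The restriction to \<open>R \<le> 1 / 2\<close>
  bounds \<open>\<phi> R\<close>, since \<open>\<phi>\<close> may be unbounded near \<open>1\<close>.
\<close>

lemma log_gap_next_scale:
  assumes \<phi>: "dimension_function \<phi>" and R: "0 < R" "R \<le> 1 / 2"
  defines "R' \<equiv> R / 2 * exp (- log_gap \<phi> (R / 2))"
  shows "log_gap \<phi> (R / 2) \<le> 2 * log_gap \<phi> R"
    and "log_gap \<phi> R' \<le> (2 + 2 * \<phi> (1 / 2)) * log_gap \<phi> R"
proof -
  define L where "L = ln (1 / R)"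
  define g where "g = log_gap \<phi> R"
  have L2: "L \<ge> ln 2" unfolding L_def using R by (simp add: field_simps)
  then have L: "L > 0" using ln_gt_zero[of "2::real"] by linarith
  have g: "g > 0" unfolding g_def using log_gap_pos[OF \<phi>] R by simp
  have L': "ln (1 / (R / 2)) = L + ln 2" unfolding L_def using R by (simp add: ln_div)
  have half: "log_gap \<phi> (R / 2) > 0" using log_gap_pos[OF \<phi>] R by simp
  have "log_gap \<phi> (R / 2) * L \<le> g * (L + ln 2)"
    using log_gap_sublinear[OF \<phi>, of "R / 2" R] R unfolding g_def L' L_def[symmetric] by simp
  also have "\<dots> \<le> g * (2 * L)" using L2 g by (intro mult_left_mono) auto
  finally have "log_gap \<phi> (R / 2) * L \<le> (2 * g) * L" by simp
  then show 1: "log_gap \<phi> (R / 2) \<le> 2 * log_gap \<phi> R" using L unfolding g_def by simp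
  have "R' \<le> R / 2 * 1"
    unfolding R'_def by (rule mult_left_mono) (use R half in auto)
  then have "R' \<le> R" using R by linarith
  moreover have "0 < R'" unfolding R'_def using R by simp
  ultimately have R': "0 < R'" "R' \<le> R" by auto
  have "ln (1 / R') = L + ln 2 + log_gap \<phi> (R / 2)"
    unfolding R'_def L_def using R by (simp add: ln_div ln_mult)
  also have "\<dots> \<le> 2 * L + 2 * g" using 1 L2 unfolding g_def by linarith
  finally have L1: "ln (1 / R') \<le> 2 * L + 2 * g" .
  have "\<phi> R \<le> \<phi> (1 / 2)"
    using \<phi> R unfolding dimension_function_def by (auto dest!: mono_onD[where r = R and s = "1/2"])
  then have "g \<le> \<phi> (1 / 2) * L" unfolding g_def log_gap_def L_def[symmetric] using L by simp
  with L1 have L3: "ln (1 / R') \<le> (2 + 2 * \<phi> (1 / 2)) * L" by (simp add: algebra_simps)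
  have "log_gap \<phi> R' * L \<le> g * ln (1 / R')"
    using log_gap_sublinear[OF \<phi> R'] R unfolding g_def L_def by simp
  also have "\<dots> \<le> g * ((2 + 2 * \<phi> (1 / 2)) * L)" using L3 g by (intro mult_left_mono) auto
  finally have "log_gap \<phi> R' * L \<le> ((2 + 2 * \<phi> (1 / 2)) * g) * L" by (simp add: mult_ac)
  then show "log_gap \<phi> R' \<le> (2 + 2 * \<phi> (1 / 2)) * log_gap \<phi> R" using L unfolding g_def by simp
qed

text \<open>
  Induction on the number of halvings separating \<open>R\<close> from \<open>r\<close>. If \<open>r\<close> is too small for
  interpolation, the ball is split at the radius \<open>R1 = (R / 2) powr (1 + \<phi> (R / 2))\<close>:
  interpolation handles the pair \<open>(R / 2, R1)\<close>, the induction hypothesis handles \<open>(R1, r)\<close>. The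
  constant is the same on both sides of the induction because interpolation provides the factor
  \<open>K\<close> in advance.
\<close>

lemma cover_lb_small_scales:
  assumes D: "doubling_const F C" and \<phi>: "dimension_function \<phi>"
    and lower: "\<And>\<alpha>. 0 < \<alpha> \<Longrightarrow> \<alpha> < 1 \<Longrightarrow>
      \<exists>c>0. \<forall>R. 0 < R \<and> R < 1 \<longrightarrow>
        cover_lb F R (R powr (1 + \<phi> R / \<alpha>)) (c * R powr (- (\<phi> R / \<alpha> * s)))"
    and t: "0 \<le> t" "t < s"
  shows "\<exists>b. 0 < b \<and> b < 1 \<and> (\<forall>R r. 0 < R \<and> R \<le> b \<and> 0 < r \<and> log_gap \<phi> R \<le> ln (R / r)
     \<longrightarrow> cover_lb F R r ((R / r) powr t))"
proof -
  have C: "C > 1" using D unfolding doubling_const_def by auto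
  \<comment> \<open>\<open>2 powr t\<close> pays for replacing \<open>R\<close> by \<open>R / 2\<close>, the rest for replacing \<open>R1\<close> by \<open>4 * R1\<close>\<close>
  define K where "K = 2 powr t * (C * 4 powr log 2 C)"
  have "2 powr t \<ge> 1" "4 powr log 2 C \<ge> 1" using t C by (auto intro!: ge_one_powr_ge_zero)
  then have K: "K \<ge> 1" unfolding K_def using C by (metis less_eq_real_def mult_ge1_I)
  \<comment> \<open>\<open>2 + 2 * \<phi> (1 / 2)\<close> bounds the growth of the gap; the halving costs one more multiple of the
     gap and the step to \<open>R1\<close> two more\<close>
  define M where "M = 5 + 2 * \<phi> (1 / 2)"
  have "\<phi> (1 / 2) > 0" using \<phi> unfolding dimension_function_def by simp
  then have M: "M \<ge> 5" unfolding M_def by simp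
  obtain b1 where b1: "b1 > 0" and step: "\<And>R r. 0 < R \<Longrightarrow> R < b1 \<Longrightarrow> R < 1 \<Longrightarrow> 0 < r \<Longrightarrow>
      log_gap \<phi> R \<le> ln (R / r) \<Longrightarrow> ln (R / r) \<le> M * log_gap \<phi> R \<Longrightarrow>
      cover_lb F R r (K * (R / r) powr t)"
    using cover_lb_intermediate_scales[OF D \<phi> lower t, of K M] K by auto
  obtain b2 where b2: "0 < b2" "\<And>R. 0 < R \<Longrightarrow> R < b2 \<Longrightarrow> ln 2 \<le> log_gap \<phi> R"
    using log_gap_large[OF \<phi>] by blast
  define b where "b = min (1 / 2) (min b1 b2 / 2)"
  have b: "0 < b" "b \<le> 1 / 2" "b < b1" "b < b2" using b1 b2(1) unfolding b_def by auto
  have "cover_lb F R r ((R / r) powr t)"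
    if "0 < R" "R \<le> b" "0 < r" "log_gap \<phi> R \<le> ln (R / r)" "R \<le> 2 ^ n * r" for n R r
    using that
  proof (induction n arbitrary: R)
    case 0
    then have "R / r \<le> 1" by simp
    then have "ln (R / r) \<le> 0" using 0 by (subst ln_le_zero_iff) auto
    moreover have "log_gap \<phi> R > 0" using log_gap_pos[OF \<phi>, of R] 0 b by simp
    ultimately have False using "0"(4) by linarith
    then show ?case ..
  next
    case (Suc n)
    note R = Suc.prems
    have g2: "ln 2 \<le> log_gap \<phi> R" using b2(2)[of R] R b by simp
    show ?case
    proof (cases "ln (R / r) \<le> M * log_gap \<phi> R")
      case True
      have "cover_lb F R r (K * (R / r) powr t)" using step[of R r] True R b by simp
      moreover have "1 * (R / r) powr t \<le> K * (R / r) powr t" using K by (intro mult_right_mono) auto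
      ultimately show ?thesis using cover_lb_weaken[of F R r "K * (R / r) powr t" R] by simp
    next
      case False
      define R1 where "R1 = R / 2 * exp (- log_gap \<phi> (R / 2))"
      have half: "log_gap \<phi> (R / 2) > 0" using log_gap_pos[OF \<phi>] R b by simp
      have "R1 \<le> R / 2 * 1"
        unfolding R1_def by (rule mult_left_mono) (use R half in auto)
      then have R1: "0 < R1" "R1 \<le> R / 2" unfolding R1_def using R by auto
      have next_le: "log_gap \<phi> (R / 2) \<le> 2 * log_gap \<phi> R"
          "log_gap \<phi> R1 \<le> (2 + 2 * \<phi> (1 / 2)) * log_gap \<phi> R"
        unfolding R1_def using log_gap_next_scale[OF \<phi>, of R] R b by auto
      have lnR1: "ln (R / 2 / R1) = log_gap \<phi> (R / 2)"
        unfolding R1_def using R by (simp add: ln_div ln_mult)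
      have "ln (R1 / r) = ln (R / r) - ln 2 - log_gap \<phi> (R / 2)"
        unfolding R1_def using R by (simp add: ln_div ln_mult)
      moreover have "M * log_gap \<phi> R = (2 + 2 * \<phi> (1 / 2)) * log_gap \<phi> R + 3 * log_gap \<phi> R"
        unfolding M_def by (simp add: algebra_simps)
      ultimately have gap: "log_gap \<phi> R1 \<le> ln (R1 / r)" using False next_le g2 by linarith
      have IH: "cover_lb F R1 r ((R1 / r) powr t)"
        using Suc.IH[of R1] R1 R gap by simp
      have "log_gap \<phi> R1 > 0" using log_gap_pos[OF \<phi>, of R1] R1 R b by simp
      with gap have "0 < ln (R1 / r)" by linarith
      then have rR1: "r \<le> R1" using R1 R by simp
      have "log_gap \<phi> (R / 2) * 1 \<le> log_gap \<phi> (R / 2) * M" using half M by (intro mult_left_mono) auto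
      then have "cover_lb F (R / 2) R1 (K * (R / 2 / R1) powr t)"
        using step[of "R / 2" R1] R R1 b lnR1 by (simp add: mult.commute)
      from cover_lb_coarsen[OF D this R1(1), of "4 * R1"]
      have "cover_lb F (R / 2) (4 * R1) (K * (R / 2 / R1) powr t / (C * 4 powr log 2 C))"
        using R1 by simp
      also have "K * (R / 2 / R1) powr t / (C * 4 powr log 2 C) = 2 powr t * (R / 2 / R1) powr t"
        unfolding K_def using C by simp
      also have "\<dots> = (R / R1) powr t" using R R1 by (simp add: powr_mult[symmetric])
      finally have "cover_lb F (R / 2) (4 * R1) ((R / R1) powr t)" .
      from cover_lb_mult[OF this IH _ rR1 R1(2)] R
      have "cover_lb F R r ((R / R1) powr t * (R1 / r) powr t)" by simp
      then show ?thesis using R R1 by (simp add: powr_mult[symmetric])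
    qed
  qed
  moreover have "\<exists>n. R \<le> 2 ^ n * r" if "0 < r" for R r :: real
  proof -
    obtain n where "R / r < 2 ^ n" using real_arch_pow[of 2 "R / r"] by auto
    then show ?thesis using that by (intro exI[of _ n]) (simp add: field_simps)
  qed
  ultimately have "cover_lb F R r ((R / r) powr t)"
    if "0 < R" "R \<le> b" "0 < r" "log_gap \<phi> R \<le> ln (R / r)" for R r using that by blast
  with b show ?thesis by (intro exI[of _ b]) auto
qed

text \<open>
  For \<open>R\<close> above the threshold \<open>b\<close> there are two cases, separated by \<open>r0 = b powr (1 + \<phi> b)\<close>: if
  \<open>r \<le> r0\<close>, a ball of radius \<open>R\<close> contains one of radius \<open>b\<close>, to which the bound for small scales
  applies; if \<open>r > r0\<close>, then \<open>R / r\<close> is bounded and one ball is enough. The constant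
  \<open>r0 powr t\<close> serves every case.
\<close>

lemma cover_lb_all_scales:
  assumes D: "doubling_const F C" and \<phi>: "dimension_function \<phi>"
    and lower: "\<And>\<alpha>. 0 < \<alpha> \<Longrightarrow> \<alpha> < 1 \<Longrightarrow>
      \<exists>c>0. \<forall>R. 0 < R \<and> R < 1 \<longrightarrow>
        cover_lb F R (R powr (1 + \<phi> R / \<alpha>)) (c * R powr (- (\<phi> R / \<alpha> * s)))"
    and t: "0 \<le> t" "t < s"
  shows "\<exists>c>0. \<forall>r R. 0 < r \<and> r \<le> R powr (1 + \<phi> R) \<and> R powr (1 + \<phi> R) < R \<and> R < 1 \<longrightarrow>
    cover_lb F R r (c * (R / r) powr t)"
proof -
  obtain b where b: "0 < b" "b < 1" and small: "\<And>R r. 0 < R \<Longrightarrow> R \<le> b \<Longrightarrow> 0 < r \<Longrightarrow>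
      log_gap \<phi> R \<le> ln (R / r) \<Longrightarrow> cover_lb F R r ((R / r) powr t)"
    using cover_lb_small_scales[OF D \<phi> lower t] by blast
  define r0 where "r0 = b powr (1 + \<phi> b)"
  have \<phi>b: "\<phi> b > 0" using \<phi> b unfolding dimension_function_def by auto
  have "b powr (1 + \<phi> b) \<le> b powr 1" using b \<phi>b by (intro powr_mono') auto
  then have r0: "0 < r0" "r0 \<le> b" unfolding r0_def using b by auto
  have "cover_lb F R r (r0 powr t * (R / r) powr t)"
    if r: "0 < r" "r \<le> R powr (1 + \<phi> R)" and Rr: "R powr (1 + \<phi> R) < R" and "R < 1" for r R
  proof -
    have R: "0 < R" using r Rr by linarith
    have "r0 powr t * (R / r) powr t = (r0 * (R / r)) powr t"
      by (rule powr_mult[symmetric])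
    also have le: "(r0 * (R / r)) powr t \<le> z powr t" if "r0 * (R / r) \<le> z" for z
      using that r0 R r t by (intro powr_mono2) auto
    note le
    finally have le: "r0 powr t * (R / r) powr t \<le> z powr t" if "r0 * (R / r) \<le> z" for z
      using that .
    consider "R \<le> b" | "R > b" "r \<le> r0" | "R > b" "r > r0" by linarith
    then show ?thesis
    proof cases
      case 1
      have "r0 * (R / r) \<le> 1 * (R / r)" using r0 b R r by (intro mult_right_mono) auto
      then show ?thesis
        using small[of R r] 1 R r le le_powr_iff_log_gap[of R r \<phi>]
        by (auto intro!: cover_lb_weaken[of F R r "(R / r) powr t"])
    next
      case 2
      have "r0 * R \<le> b * 1" using r0 R \<open>R < 1\<close> b by (intro mult_mono) auto
      then have "r0 * (R / r) \<le> b / r" using r by (simp add: divide_right_mono)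
      then show ?thesis
        using small[of b r] 2 b r le le_powr_iff_log_gap[of b r \<phi>] unfolding r0_def
        by (auto intro!: cover_lb_weaken[of F b r "(b / r) powr t"])
    next
      case 3
      have "r0 * R \<le> r * 1" using r0 R \<open>R < 1\<close> r 3 by (intro mult_mono) auto
      then have "r0 * (R / r) \<le> 1" using r by (simp add: field_simps)
      from le[OF this] have "r0 powr t * (R / r) powr t \<le> 1" by simp
      with cover_lb_one[OF R] show ?thesis by (rule cover_lb_weaken[OF _ order_refl])
    qed
  qed
  moreover have "r0 powr t > 0" using r0 by simp
  ultimately show ?thesis by blast
qed

section \<open>Comparison of the two dimensions\<close>

lemma quasi_lower_dim_le_lower_dim:
  assumes \<phi>: "dimension_function \<phi>" and \<alpha>: "0 < \<alpha>" "\<alpha> < 1"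
  shows "quasi_lower_dim \<phi> F \<le> lower_dim (\<lambda>R. \<phi> R / \<alpha>) F"
  unfolding quasi_lower_dim_def lower_dim_def cover_lb_iff
proof (rule Sup_subset_mono, safe)
  fix s c :: real
  assume s: "0 \<le> s" and c: "0 < c"
    and lb: "\<forall>r R. 0 < r \<and> r \<le> R powr (1 + \<phi> R) \<and> R powr (1 + \<phi> R) < R \<and> R < 1 \<longrightarrow>
      cover_lb F R r (c * (R / r) powr s)"
  have "cover_lb F R (R powr (1 + \<phi> R / \<alpha>)) (c * R powr (- (\<phi> R / \<alpha> * s)))"
    if R: "0 < R" "R < 1" for R
  proof -
    have \<phi>R: "\<phi> R > 0" using \<phi> R unfolding dimension_function_def by auto
    then have "\<phi> R \<le> \<phi> R / \<alpha>" using \<alpha> by (simp add: field_simps)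
    then have 1: "R powr (1 + \<phi> R / \<alpha>) \<le> R powr (1 + \<phi> R)" using R by (intro powr_mono') auto
    have "R powr (1 + \<phi> R) < R powr 1" using R \<phi>R by (intro powr_less_mono') auto
    with 1 R lb have "cover_lb F R (R powr (1 + \<phi> R / \<alpha>)) (c * (R / R powr (1 + \<phi> R / \<alpha>)) powr s)"
      by simp
    also have "R / R powr (1 + \<phi> R / \<alpha>) = R powr (- (\<phi> R / \<alpha>))"
      using R powr_diff[of R 1 "1 + \<phi> R / \<alpha>"] by simp
    also have "\<dots> powr s = R powr (- (\<phi> R / \<alpha> * s))" by (simp add: powr_powr)
    finally show ?thesis .
  qed
  then show "\<exists>s'. ereal s = ereal s' \<and> 0 \<le> s' \<and> (\<exists>C>0. \<forall>R. 0 < R \<and> R < 1 \<longrightarrow>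
      cover_lb F R (R powr (1 + \<phi> R / \<alpha>)) (C * R powr (- (\<phi> R / \<alpha> * s'))))"
    using s c by blast
qed

text \<open>The admissible exponents are closed downwards.\<close>

lemma lower_dim_gtD:
  assumes "ereal s < lower_dim \<psi> F" and \<psi>: "\<And>R. 0 < R \<Longrightarrow> R < 1 \<Longrightarrow> \<psi> R \<ge> 0"
  shows "\<exists>c>0. \<forall>R. 0 < R \<and> R < 1 \<longrightarrow>
    cover_lb F R (R powr (1 + \<psi> R)) (c * R powr (- (\<psi> R * s)))"
proof -
  obtain s' c where s': "s < s'" and c: "c > 0" and
    lb: "\<And>R. 0 < R \<Longrightarrow> R < 1 \<Longrightarrow> cover_lb F R (R powr (1 + \<psi> R)) (c * R powr (- (\<psi> R * s')))"
    using assms(1) unfolding lower_dim_def cover_lb_iff less_Sup_iff by auto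
  have "cover_lb F R (R powr (1 + \<psi> R)) (c * R powr (- (\<psi> R * s)))" if R: "0 < R" "R < 1" for R
  proof (rule cover_lb_weaken[OF lb[OF R] order_refl])
    have "\<psi> R * s \<le> \<psi> R * s'" using \<psi>[OF R] s' by (intro mult_left_mono) auto
    then have "R powr (- (\<psi> R * s)) \<le> R powr (- (\<psi> R * s'))" using R by (intro powr_mono') auto
    then show "c * R powr (- (\<psi> R * s)) \<le> c * R powr (- (\<psi> R * s'))" using c by simp
  qed
  with c show ?thesis by blast
qed

lemma le_quasi_lower_dim:
  assumes "0 \<le> t" "\<exists>c>0. \<forall>r R. 0 < r \<and> r \<le> R powr (1 + \<phi> R) \<and> R powr (1 + \<phi> R) < R \<and> R < 1 \<longrightarrow>
    cover_lb F R r (c * (R / r) powr t)"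
  shows "ereal t \<le> quasi_lower_dim \<phi> F"
  unfolding quasi_lower_dim_def cover_lb_iff
  by (rule Sup_upper, rule CollectI, rule exI[of _ t], intro conjI refl assms)

lemma quasi_lower_dim_nonneg: "0 \<le> quasi_lower_dim \<phi> F"
proof -
  have "cover_lb F R r (1 * (R / r) powr 0)" if "0 < r" "r \<le> R powr (1 + \<phi> R)" "R powr (1 + \<phi> R) < R" for r R
    using that by (intro cover_lb_weaken[OF cover_lb_one order_refl]) auto
  then have "ereal 0 \<le> quasi_lower_dim \<phi> F"
    by (intro le_quasi_lower_dim) (auto intro!: exI[of _ 1])
  then show ?thesis by (simp add: zero_ereal_def)
qed

theorem theorem2:
  fixes F :: "'a::metric_space set" and \<phi> :: "real \<Rightarrow> real"
  assumes "nbd_space F" and "dimension_function \<phi>"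
  shows "quasi_lower_dim \<phi> F = (INF \<alpha>\<in>{0<..<1::real}. lower_dim (\<lambda>R. \<phi> R / \<alpha>) F)"
proof (rule antisym)
  show "quasi_lower_dim \<phi> F \<le> (INF \<alpha>\<in>{0<..<1::real}. lower_dim (\<lambda>R. \<phi> R / \<alpha>) F)"
    using quasi_lower_dim_le_lower_dim[OF assms(2)] by (intro INF_greatest) auto
  show "(INF \<alpha>\<in>{0<..<1::real}. lower_dim (\<lambda>R. \<phi> R / \<alpha>) F) \<le> quasi_lower_dim \<phi> F"
  proof (rule ccontr)
    assume "\<not> ?thesis"
    then obtain s where s: "quasi_lower_dim \<phi> F < ereal s"
        and s_inf: "ereal s < (INF \<alpha>\<in>{0<..<1::real}. lower_dim (\<lambda>R. \<phi> R / \<alpha>) F)"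
      using ereal_dense2 by (metis not_le)
    obtain t where t: "quasi_lower_dim \<phi> F < ereal t" "t < s"
      using ereal_dense2[OF s] by auto
    have "0 < ereal t" using quasi_lower_dim_nonneg t(1) by (rule le_less_trans)
    then have t0: "0 \<le> t" by simp
    obtain C where C: "doubling_const F C"
      using assms(1) doubling_constE unfolding nbd_space_def by blast
    have "\<exists>c>0. \<forall>R. 0 < R \<and> R < 1 \<longrightarrow>
        cover_lb F R (R powr (1 + \<phi> R / \<alpha>)) (c * R powr (- (\<phi> R / \<alpha> * s)))"
      if \<alpha>: "0 < \<alpha>" "\<alpha> < 1" for \<alpha>
    proof (rule lower_dim_gtD)
      show "ereal s < lower_dim (\<lambda>R. \<phi> R / \<alpha>) F"
        by (rule less_le_trans[OF s_inf INF_lower]) (use \<alpha> in simp)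
      show "0 \<le> \<phi> R / \<alpha>" if "0 < R" "R < 1" for R
        using assms(2) that \<alpha> unfolding dimension_function_def by (simp add: less_imp_le)
    qed
    from le_quasi_lower_dim[OF t0 cover_lb_all_scales[OF C assms(2) this t0 t(2)]]
    show False using t(1) by simp
  qed
qed

end
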